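(* For every $\delta\ge1$, any deterministic algorithm for the $k$-median problem that has a running time of $O(kn\delta)$ on a metric space of size $n$ has an approximation ratio of $$\Omega\!\left(\frac{\log n}{\log\log n+\log k+\log\delta}\right).$$
   Context: Given a finite metric space $(V,d)$ of size $n$ (unit weights) and an integer $k$, the $k$-median problem asks for $S\subseteq V$, $|S|\le k$, minimizing $\sum_{x\in V}d(x,S)$, where $d(x,S)=\min_{y\in S}d(x,y)$. An algorithm accesses the metric only by querying distances $d(x,y)$ (each query costs at least one unit of time). Its approximation ratio is the worst-case ratio of the cost of its output to the optimal cost. *)

theory Defs
  imports "HOL-Analysis.Abstract_Metric_Spaces" "HOL-Library.Extended_Real"
begin

text \<open>
  The points of a metric space of size n are identified with their labels 0, ..., n - 1.
  A solution is nonempty because the distance to the empty set is undefined.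
\<close>

definition solutions :: "nat \<Rightarrow> nat \<Rightarrow> nat set set" where
  "solutions n k = {S. S \<subseteq> {..<n} \<and> S \<noteq> {} \<and> card S \<le> k}"

definition dist_to :: "(nat \<Rightarrow> nat \<Rightarrow> real) \<Rightarrow> nat \<Rightarrow> nat set \<Rightarrow> real" where
  "dist_to d x S = Min ((\<lambda>y. d x y) ` S)"

definition cost :: "nat \<Rightarrow> (nat \<Rightarrow> nat \<Rightarrow> real) \<Rightarrow> nat set \<Rightarrow> real" where
  "cost n d S = (\<Sum>x<n. dist_to d x S)"

definition opt :: "nat \<Rightarrow> nat \<Rightarrow> (nat \<Rightarrow> nat \<Rightarrow> real) \<Rightarrow> real" where
  "opt n k d = Min (cost n d ` solutions n k)"

text \<open>
  A deterministic computation whose only access to the metric is by adaptive distance queries.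
  Each query and each other elementary step takes one unit of time; a query of larger cost
  is a query preceded by steps. How the next action is determined
  from the answers received so far is unrestricted, so the model includes every
  deterministic algorithm that halts on every input, uniform or not.
\<close>

datatype computation =
    Return "nat set"
  | Step computation
  | Query nat nat "real \<Rightarrow> computation"

primrec result :: "computation \<Rightarrow> (nat \<Rightarrow> nat \<Rightarrow> real) \<Rightarrow> nat set" where
  "result (Return S) d = S"
| "result (Step P) d = result P d"
| "result (Query x y f) d = result (f (d x y)) d"

primrec running_time :: "computation \<Rightarrow> (nat \<Rightarrow> nat \<Rightarrow> real) \<Rightarrow> nat" where
  "running_time (Return S) d = 0"
| "running_time (Step P) d = Suc (running_time P d)"
| "running_time (Query x y f) d = Suc (running_time (f (d x y)) d)"

text \<open>An algorithm is given the size n and the parameter k.\<close>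

definition kmedian_algorithm :: "(nat \<Rightarrow> nat \<Rightarrow> computation) \<Rightarrow> bool" where
  "kmedian_algorithm A \<longleftrightarrow>
    (\<forall>n\<ge>1. \<forall>k\<ge>1. \<forall>d. Metric_space {..<n} d \<longrightarrow> result (A n k) d \<in> solutions n k)"

text \<open>
  If the optimum is 0 (which happens exactly when k is at least n), an optimal output has
  ratio 1 and any other output has ratio \<open>\<infinity>\<close>.
\<close>

definition cost_ratio :: "real \<Rightarrow> real \<Rightarrow> ereal" where
  "cost_ratio a b = (if a = b then 1 else ereal a / ereal b)"

definition approximation_ratio :: "(nat \<Rightarrow> nat \<Rightarrow> computation) \<Rightarrow> nat \<Rightarrow> nat \<Rightarrow> ereal" where
  "approximation_ratio A n k =
    (SUP d \<in> {d. Metric_space {..<n} d}. cost_ratio (cost n d (result (A n k) d)) (opt n k d))"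

end

theory Submission imports Defs begin

text \<open>
  An adversary keeps a metric \<open>g\<close> of upper bounds, initially discrete with a large distance, and
  imagines an extra point, the hub, at distance \<open>hub x = 1 + ln (mass x) / L\<close> from \<open>x\<close>, where
  \<open>mass x = (\<Sum>y. exp (- L * g x y))\<close>. A query is answered with the shorter of \<open>g x y\<close> and the route
  through the hub; the answer is then recorded in \<open>g\<close> as an edge. This raises the total mass by at
  most 2, so after \<open>O(k n \<delta>)\<close> queries the average mass is \<open>O(k \<delta>)\<close>, and with
  \<open>L = ln (ln n) + ln k + ln \<delta>\<close> the distances to the hub sum to \<open>O(n)\<close>. A ball of \<open>g\<close> with radius
  \<open>R = ln n / (8 L)\<close> has few points, because each of its points has mass at least
  \<open>exp (- 2 L R)\<close> times the size of the ball. Hence the points near the output can be moved to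
  distance about \<open>R\<close> from the hub: the output then costs \<open>\<Omega>(R n)\<close>, while the point nearest to the
  hub costs \<open>O(n)\<close>.
\<close>

section \<open>Masses and distances to the hub\<close>

text \<open>A smoothed size of the ball around \<open>x\<close>: a point at distance t counts with
  weight exp(-L t).\<close>

definition mass :: "'a set \<Rightarrow> real \<Rightarrow> ('a \<Rightarrow> 'a \<Rightarrow> real) \<Rightarrow> 'a \<Rightarrow> real" where
  "mass V L g x = (\<Sum>y\<in>V. exp (- L * g x y))"

text \<open>The logarithm of the mass makes this 1-Lipschitz in \<open>g\<close>; the summand 1
  keeps it positive even where the mass is 1.\<close>

definition hub :: "'a set \<Rightarrow> real \<Rightarrow> ('a \<Rightarrow> 'a \<Rightarrow> real) \<Rightarrow> 'a \<Rightarrow> real" where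
  "hub V L g x = 1 + ln (mass V L g x) / L"

definition via_hub :: "('a \<Rightarrow> 'a \<Rightarrow> real) \<Rightarrow> ('a \<Rightarrow> real) \<Rightarrow> 'a \<Rightarrow> 'a \<Rightarrow> real" where
  "via_hub g h x y = min (g x y) (h x + h y)"

text \<open>The shortest-path metric after an edge of length \<open>w\<close> joins \<open>x\<close>
  and \<open>y\<close>: a shortest path uses the edge at most once, in one of two
  directions.\<close>

definition add_edge :: "('a \<Rightarrow> 'a \<Rightarrow> real) \<Rightarrow> 'a \<Rightarrow> 'a \<Rightarrow> real \<Rightarrow> 'a \<Rightarrow> 'a \<Rightarrow> real" where
  "add_edge g x y w a b = min (g a b) (min (g a x + w + g y b) (g a y + w + g x b))"

lemma mass_ge_1:
  assumes "finite V" "Metric_space V g" "x \<in> V"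
  shows "1 \<le> mass V L g x"
proof -
  interpret Metric_space V g by fact
  have "exp (- L * g x x) \<le> mass V L g x"
    unfolding mass_def using assms by (intro member_le_sum) auto
  then show ?thesis using assms by simp
qed

lemma mass_mono:
  assumes "L > 0" "\<And>x y. \<lbrakk>x \<in> V; y \<in> V\<rbrakk> \<Longrightarrow> g' x y \<le> g x y" "x \<in> V"
  shows "mass V L g x \<le> mass V L g' x"
  unfolding mass_def using assms by (intro sum_mono) simp

lemma hub_ge_1:
  assumes "finite V" "Metric_space V g" "L > 0" "x \<in> V"
  shows "1 \<le> hub V L g x"
  using mass_ge_1[OF assms(1,2,4), of L] assms(3) by (simp add: hub_def)

text \<open>By the triangle inequality, moving from \<open>x\<close> to \<open>y\<close> changes
  each exponent by at most \<open>L * g x y\<close>.\<close>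

lemma mass_shift:
  assumes "Metric_space V g" "L > 0" "x \<in> V" "y \<in> V"
  shows "mass V L g x \<le> exp (L * g x y) * mass V L g y"
proof -
  interpret Metric_space V g by fact
  have "exp (- L * g x z) \<le> exp (L * g x y) * exp (- L * g y z)" if "z \<in> V" for z
  proof -
    have "g y z \<le> g x y + g x z" using triangle[of y x z] assms that by (simp add: commute)
    then have "L * g y z \<le> L * g x y + L * g x z"
      using \<open>L > 0\<close> by (metis distrib_left mult_le_cancel_left_pos)
    then show ?thesis by (simp flip: exp_add)
  qed
  then show ?thesis unfolding mass_def sum_distrib_left by (rule sum_mono)
qed

text \<open>The logarithm of \<open>mass_shift\<close>, divided by \<open>L\<close>. It gives those
  triangle inequalities in which the hub is an endpoint.\<close>

lemma hub_lipschitz: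
  assumes "finite V" "Metric_space V g" "L > 0" "x \<in> V" "y \<in> V"
  shows "hub V L g x \<le> g x y + hub V L g y"
proof -
  have pos: "0 < mass V L g x" "0 < mass V L g y"
    using mass_ge_1[OF assms(1,2,4), of L] mass_ge_1[OF assms(1,2,5), of L] by auto
  have "ln (mass V L g x) \<le> ln (exp (L * g x y) * mass V L g y)"
    using pos mass_shift[OF assms(2-5)] by simp
  also have "\<dots> = L * g x y + ln (mass V L g y)" using pos by (simp add: ln_mult)
  finally have "ln (mass V L g x) / L \<le> (L * g x y + ln (mass V L g y)) / L"
    using \<open>L > 0\<close> by (intro divide_right_mono) auto
  then show ?thesis using \<open>L > 0\<close> by (simp add: hub_def add_divide_distrib)
qed

section \<open>Metrics shortened through the hub or by a new edge\<close>

text \<open>If both legs pass through the hub, the detour over \<open>y\<close> only adds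
  \<open>2 * h y\<close>; if one does, the Lipschitz condition absorbs the direct leg.\<close>

lemma via_hub_triangle:
  assumes "Metric_space V g"
    and lip: "\<And>x y. \<lbrakk>x \<in> V; y \<in> V\<rbrakk> \<Longrightarrow> h x \<le> g x y + h y"
    and pos: "\<And>x. x \<in> V \<Longrightarrow> 0 < h x"
    and V: "x \<in> V" "y \<in> V" "z \<in> V"
  shows "via_hub g h x z \<le> via_hub g h x y + via_hub g h y z"
proof -
  interpret Metric_space V g by fact
  show ?thesis
    using triangle[OF V] lip[of x y] lip[of z y] pos[of y] V commute[of y z]
    by (auto simp: via_hub_def min_def)
qed

text \<open>\<open>Metric_space\<close> demands symmetry and nonnegativity on the whole type, hence
  the value 0 outside \<open>V\<close>.\<close>

lemma Metric_space_via_hub: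
  assumes "Metric_space V g"
    and lip: "\<And>x y. \<lbrakk>x \<in> V; y \<in> V\<rbrakk> \<Longrightarrow> h x \<le> g x y + h y"
    and pos: "\<And>x. x \<in> V \<Longrightarrow> 0 < h x"
  shows "Metric_space V (\<lambda>x y. if x \<in> V \<and> y \<in> V then via_hub g h x y else 0)"
proof -
  interpret Metric_space V g by fact
  show ?thesis
  proof
    fix x y assume "x \<in> V" "y \<in> V"
    then have "0 < h x + h y" "g x y = 0 \<longleftrightarrow> x = y"
      using pos by (simp_all add: add_pos_pos)
    then show "((if x \<in> V \<and> y \<in> V then via_hub g h x y else 0) = 0) = (x = y)"
      using \<open>x \<in> V\<close> \<open>y \<in> V\<close> nonneg[of x y] unfolding via_hub_def by (smt (verit))
  next
    fix x y z assume "x \<in> V" "y \<in> V" "z \<in> V"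
    then show "(if x \<in> V \<and> z \<in> V then via_hub g h x z else 0)
      \<le> (if x \<in> V \<and> y \<in> V then via_hub g h x y else 0) + (if y \<in> V \<and> z \<in> V then via_hub g h y z else 0)"
      using via_hub_triangle[OF assms] by simp
  qed (auto simp: via_hub_def commute add.commute pos intro: less_imp_le[OF add_pos_pos])
qed

lemma Metric_space_add_edge:
  assumes "Metric_space V g" "x \<in> V" "y \<in> V" "0 < w"
  shows "Metric_space V (add_edge g x y w)"
proof -
  interpret Metric_space V g by fact
  show ?thesis
  proof
    fix a b assume "a \<in> V" "b \<in> V"
    moreover have "0 < g a x + w + g y b" "0 < g a y + w + g x b"
      using \<open>0 < w\<close> by (simp_all add: add_nonneg_pos add_pos_nonneg)
    ultimately show "(add_edge g x y w a b = 0) = (a = b)"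
      using nonneg[of a b] zero[of a b] unfolding add_edge_def min_def by (smt (verit))
  next
    fix a b c assume V: "a \<in> V" "b \<in> V" "c \<in> V"
    have tri: "g p r \<le> g p q + g q r" if "p \<in> V" "q \<in> V" "r \<in> V" for p q r
      using that triangle by blast
    have le: "add_edge g x y w a c \<le> g a c" "add_edge g x y w a c \<le> g a x + w + g y c"
      "add_edge g x y w a c \<le> g a y + w + g x c"
      by (simp_all add: add_edge_def)
    note facts = le tri[of a b c] tri[of a b x] tri[of a b y] tri[of x b c] tri[of y b c]
      tri[of a x c] tri[of a y c] nonneg[of x b] nonneg[of b x] nonneg[of y b] nonneg[of b y]
    \<comment> \<open>Nine pairs of routes. Two passes over the edge in the same direction reduce to
      one pass, two in opposite directions to none.\<close>
    have "add_edge g x y w a c \<le> u + v"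
      if "u \<in> {g a b, g a x + w + g y b, g a y + w + g x b}"
         "v \<in> {g b c, g b x + w + g y c, g b y + w + g x c}" for u v
      using that by (elim insertE emptyE) (use facts V assms in linarith)+
    then show "add_edge g x y w a c \<le> add_edge g x y w a b + add_edge g x y w b c"
      unfolding add_edge_def[of g x y w a b] add_edge_def[of g x y w b c]
      by (smt (verit) insertCI min_def)
  qed (use \<open>0 < w\<close> in \<open>auto simp: add_edge_def commute add.commute add.left_commute min.commute\<close>)
qed

text \<open>
  The weight makes the factor \<open>exp (- L * w)\<close> cancel the masses of both endpoints, so the two
  families of new paths each contribute at most 1 to the total.
\<close>
lemma sum_mass_add_edge:
  assumes "finite V" "Metric_space V g" "L > 0" "x \<in> V" "y \<in> V"
    and w: "w = hub V L g x + hub V L g y"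
  shows "(\<Sum>a\<in>V. mass V L (add_edge g x y w) a) \<le> (\<Sum>a\<in>V. mass V L g a) + 2"
proof -
  interpret Metric_space V g by fact
  let ?e = "\<lambda>a b. exp (- L * g a b)"
  have pos: "0 < mass V L g x" "0 < mass V L g y"
    using mass_ge_1[OF assms(1,2,4), of L] mass_ge_1[OF assms(1,2,5), of L] by auto
  have "L * w = 2 * L + ln (mass V L g x) + ln (mass V L g y)"
    using \<open>L > 0\<close> by (simp add: w hub_def field_simps)
  then have "exp (- L * w) = exp (- 2 * L) / (mass V L g x * mass V L g y)"
    using pos by (simp add: exp_diff exp_minus exp_add field_simps)
  also have "\<dots> \<le> 1 / (mass V L g x * mass V L g y)"
    using pos \<open>L > 0\<close> by (intro divide_right_mono) auto
  finally have ew: "exp (- L * w) \<le> 1 / (mass V L g x * mass V L g y)" .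
  \<comment> \<open>The exponential turns the minimum over three routes into at most a sum of three
    terms; each new term is a product, so its double sum factors into masses.\<close>
  have le: "exp (- L * add_edge g x y w a b)
      \<le> ?e a b + exp (- L * w) * (?e a x * ?e y b) + exp (- L * w) * (?e a y * ?e x b)" for a b
  proof -
    have "exp (- L * (g a x + w + g y b)) = exp (- L * w) * (?e a x * ?e y b)"
      "exp (- L * (g a y + w + g x b)) = exp (- L * w) * (?e a y * ?e x b)"
      by (simp_all add: algebra_simps flip: exp_add)
    moreover have "exp (- L * min p (min q r)) \<le> exp (- L * p) + exp (- L * q) + exp (- L * r)"
      for p q r by (simp add: min_def add_increasing add_increasing2)
    ultimately show ?thesis unfolding add_edge_def by metis
  qed
  have "(\<Sum>a\<in>V. mass V L (add_edge g x y w) a)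
      \<le> (\<Sum>a\<in>V. \<Sum>b\<in>V. ?e a b + exp (- L * w) * (?e a x * ?e y b) + exp (- L * w) * (?e a y * ?e x b))"
    unfolding mass_def by (intro sum_mono le)
  also have "\<dots> = (\<Sum>a\<in>V. mass V L g a) + 2 * (exp (- L * w) * (mass V L g x * mass V L g y))"
  proof -
    have "(\<Sum>a\<in>V. \<Sum>b\<in>V. exp (- L * w) * (?e a p * ?e q b))
        = exp (- L * w) * (mass V L g p * mass V L g q)" for p q
      by (simp only: mass_def sum_product) (simp only: sum_distrib_left commute[of _ p])
    then show ?thesis
      by (simp only: sum.distrib) (simp add: mass_def mult.commute)
  qed
  also have "\<dots> \<le> (\<Sum>a\<in>V. mass V L g a) + 2 * 1"
    using ew pos by (intro add_left_mono mult_left_mono) (simp_all add: field_simps)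
  finally show ?thesis by simp
qed

text \<open>The new edge is as long as the route from \<open>x\<close> to \<open>y\<close> through
  the hub, so by the Lipschitz property a path over it is no shorter than the direct route through
  the hub.\<close>

lemma via_hub_le_add_edge:
  assumes "finite V" "Metric_space V g" "L > 0" "x \<in> V" "y \<in> V" "a \<in> V" "b \<in> V"
    and w: "w = hub V L g x + hub V L g y"
  shows "via_hub g (hub V L g) a b \<le> add_edge g x y w a b"
proof -
  interpret Metric_space V g by fact
  note lip = hub_lipschitz[OF assms(1-3)]
  have "hub V L g a + hub V L g b \<le> g a x + w + g y b"
    "hub V L g a + hub V L g b \<le> g a y + w + g x b"
    unfolding w commute[of y b] commute[of x b]
    using lip[of a x] lip[of b y] lip[of a y] lip[of b x] assms by linarith+
  then show ?thesis
    by (simp add: via_hub_def add_edge_def min.coboundedI2)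
qed

section \<open>The adversary\<close>

text \<open>The interval of distances still possible for a pair runs from
  \<open>via_hub g (hub V L g)\<close> up to \<open>g\<close>; it shrinks at both ends.\<close>

definition sharpens :: "'a set \<Rightarrow> real \<Rightarrow> ('a \<Rightarrow> 'a \<Rightarrow> real) \<Rightarrow> ('a \<Rightarrow> 'a \<Rightarrow> real) \<Rightarrow> bool" where
  "sharpens V L g' g \<longleftrightarrow> Metric_space V g' \<and> (\<forall>x\<in>V. \<forall>y\<in>V. g' x y \<le> g x y \<and>
    via_hub g (hub V L g) x y \<le> via_hub g' (hub V L g') x y)"

text \<open>Fixing the value 0 outside \<open>V\<close> forces the answers to queries about labels
  that are not points.\<close>

definition consistent :: "'a set \<Rightarrow> real \<Rightarrow> ('a \<Rightarrow> 'a \<Rightarrow> real) \<Rightarrow> ('a \<Rightarrow> 'a \<Rightarrow> real) \<Rightarrow> bool" where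
  "consistent V L g d \<longleftrightarrow>
    (\<forall>x\<in>V. \<forall>y\<in>V. via_hub g (hub V L g) x y \<le> d x y \<and> d x y \<le> g x y) \<and>
    (\<forall>x y. \<not> (x \<in> V \<and> y \<in> V) \<longrightarrow> d x y = 0)"

lemma sharpens_refl: "Metric_space V g \<Longrightarrow> sharpens V L g g"
  by (simp add: sharpens_def)

lemma sharpens_trans: "sharpens V L g2 g1 \<Longrightarrow> sharpens V L g1 g \<Longrightarrow> sharpens V L g2 g"
  unfolding sharpens_def by (meson order_trans)

text \<open>Smaller distances mean larger masses and larger hub distances, so for the lower ends
  only the direct distance \<open>g'\<close> has to be checked.\<close>

lemma sharpensI:
  assumes "finite V" "Metric_space V g" "L > 0" "Metric_space V g'"
    and le: "\<And>a b. \<lbrakk>a \<in> V; b \<in> V\<rbrakk> \<Longrightarrow> g' a b \<le> g a b"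
    and ge: "\<And>a b. \<lbrakk>a \<in> V; b \<in> V\<rbrakk> \<Longrightarrow> via_hub g (hub V L g) a b \<le> g' a b"
  shows "sharpens V L g' g"
proof -
  have "hub V L g c \<le> hub V L g' c" if "c \<in> V" for c
    using mass_mono[OF \<open>L > 0\<close>, of V g' g c] le that mass_ge_1[OF assms(1,2) that, of L] \<open>L > 0\<close>
    by (simp add: hub_def divide_right_mono)
  then have "via_hub g (hub V L g) a b \<le> hub V L g' a + hub V L g' b" if "a \<in> V" "b \<in> V" for a b
    unfolding via_hub_def using that by (intro min.coboundedI2 add_mono)
  then show ?thesis
    using assms(4) le ge by (simp add: sharpens_def via_hub_def)
qed

text \<open>The new upper end for the pair \<open>x\<close>, \<open>y\<close> is at most the old
  lower end, so its interval collapses to a single value, the answer.\<close>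

lemma answer_query:
  assumes V: "finite V" and g: "Metric_space V g" and L: "L > 0" and xy: "x \<in> V" "y \<in> V"
  obtains g' where "sharpens V L g' g" "g' x y \<le> via_hub g (hub V L g) x y"
    "(\<Sum>a\<in>V. mass V L g' a) \<le> (\<Sum>a\<in>V. mass V L g a) + 2"
proof (cases "g x y \<le> hub V L g x + hub V L g y")
  case True
  then show ?thesis using that[of g] sharpens_refl[OF g] by (simp add: via_hub_def)
next
  case False
  define w where "w = hub V L g x + hub V L g y"
  have "0 < w"
    using hub_ge_1[OF V g L xy(1)] hub_ge_1[OF V g L xy(2)] by (simp add: w_def)
  have "Metric_space V (add_edge g x y w)"
    by (rule Metric_space_add_edge[OF g xy \<open>0 < w\<close>])
  then have "sharpens V L (add_edge g x y w) g"
    by (rule sharpensI[OF V g L])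
       (simp add: add_edge_def, rule via_hub_le_add_edge[OF V g L xy _ _ w_def])
  moreover have "add_edge g x y w x y \<le> via_hub g (hub V L g) x y"
    using Metric_space.mdist_zero[OF g xy(1)] Metric_space.mdist_zero[OF g xy(2)] False
    by (simp add: add_edge_def via_hub_def w_def)
  moreover have "(\<Sum>a\<in>V. mass V L (add_edge g x y w) a) \<le> (\<Sum>a\<in>V. mass V L g a) + 2"
    by (rule sum_mass_add_edge[OF V g L xy w_def])
  ultimately show ?thesis by (rule that)
qed

text \<open>
  An adversary whose knowledge is \<open>g\<close> answers with the distance through the hub and records the
  answer in \<open>g\<close>. Since \<open>g\<close> decreases and the distance through the hub increases, every metric
  between the two final functions agrees with all the answers.
\<close>
lemma adversary:
  assumes V: "finite V" and L: "L > 0" and "Metric_space V g"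
  shows "\<exists>g' S m. sharpens V L g' g \<and>
    (\<Sum>x\<in>V. mass V L g' x) \<le> (\<Sum>x\<in>V. mass V L g x) + 2 * real m \<and>
    (\<forall>d. consistent V L g' d \<longrightarrow> result P d = S \<and> m \<le> running_time P d)"
  using \<open>Metric_space V g\<close>
proof (induction P arbitrary: g)
  case (Return S)
  then show ?case by (intro exI[of _ g] exI[of _ S] exI[of _ 0]) (simp add: sharpens_refl)
next
  case (Step P)
  from Step.IH[OF Step.prems] show ?case
    by (simp only: result.simps running_time.simps) (meson le_SucI)
next
  case (Query x y f)
  show ?case
  proof (cases "x \<in> V \<and> y \<in> V")
    case False
    \<comment> \<open>Here the knowledge \<open>g\<close> and the count \<open>m\<close> are those
      of the continuation; only queries inside \<open>V\<close> are charged to the mass.\<close>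
    then have "d x y = 0" if "consistent V L g' d" for g' d
      using that by (simp add: consistent_def)
    with Query.IH[OF rangeI[of f 0] Query.prems] show ?thesis
      by (simp only: result.simps running_time.simps) (metis le_SucI)
  next
    case True
    define w where "w = via_hub g (hub V L g) x y"
    obtain g1 where g1: "sharpens V L g1 g" "g1 x y \<le> w"
        "(\<Sum>a\<in>V. mass V L g1 a) \<le> (\<Sum>a\<in>V. mass V L g a) + 2"
      using answer_query[OF V Query.prems L, of x y] True unfolding w_def by blast
    from g1(1) have "Metric_space V g1" by (simp add: sharpens_def)
    from Query.IH[OF rangeI[of f w] this] obtain g' S m where g': "sharpens V L g' g1"
      "(\<Sum>a\<in>V. mass V L g' a) \<le> (\<Sum>a\<in>V. mass V L g1 a) + 2 * real m"
      "\<And>d. consistent V L g' d \<Longrightarrow> result (f w) d = S \<and> m \<le> running_time (f w) d"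
      by blast
    have "d x y = w" if "consistent V L g' d" for d
    proof -
      have "via_hub g' (hub V L g') x y \<le> d x y" "d x y \<le> g' x y"
        using that True by (simp_all add: consistent_def)
      moreover have "g' x y \<le> g1 x y" "w \<le> via_hub g1 (hub V L g1) x y"
        "via_hub g1 (hub V L g1) x y \<le> via_hub g' (hub V L g') x y"
        using g'(1) g1(1) True by (simp_all add: sharpens_def w_def)
      ultimately show ?thesis using g1(2) by linarith
    qed
    then show ?thesis
      using sharpens_trans[OF g'(1) g1(1)] g'(2,3) g1(3)
      by (intro exI[of _ g'] exI[of _ S] exI[of _ "Suc m"]) auto
  qed
qed

section \<open>Consequences of a small total mass\<close>

text \<open>Two points of the ball are at distance at most \<open>2 * R\<close>, so each ordered
  pair of them contributes at least \<open>exp (- 2 * L * R)\<close> to the total mass.\<close>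

lemma card_ball_squared_le:
  assumes "finite V" "Metric_space V g" "L > 0" "s \<in> V"
  shows "(real (card {x\<in>V. g s x < R}))\<^sup>2 \<le> exp (2 * L * R) * (\<Sum>x\<in>V. mass V L g x)"
proof -
  interpret Metric_space V g by fact
  let ?B = "{x\<in>V. g s x < R}"
  have "exp (- L * (2 * R)) \<le> exp (- L * g x y)" if "x \<in> ?B" "y \<in> ?B" for x y
  proof -
    have "g x y \<le> 2 * R" using triangle[of x s y] commute[of x s] that assms by auto
    then show ?thesis using \<open>L > 0\<close> by simp
  qed
  then have "(\<Sum>x\<in>?B. \<Sum>y\<in>?B. exp (- L * (2 * R))) \<le> (\<Sum>x\<in>?B. \<Sum>y\<in>?B. exp (- L * g x y))"
    by (intro sum_mono)
  also have "\<dots> \<le> (\<Sum>x\<in>V. mass V L g x)"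
    unfolding mass_def using \<open>finite V\<close>
    by (intro order_trans[OF sum_mono[OF sum_mono2] sum_mono2] sum_nonneg) auto
  finally show ?thesis by (simp add: power2_eq_square exp_minus field_simps)
qed

text \<open>Jensen's inequality for the logarithm, by way of its tangent at
  \<open>A\<close>.\<close>

lemma sum_hub_le:
  assumes V: "finite V" and g: "Metric_space V g" and L: "L > 0" and "A > 0"
    and total: "(\<Sum>x\<in>V. mass V L g x) \<le> real (card V) * A"
  shows "(\<Sum>x\<in>V. hub V L g x) \<le> real (card V) * (1 + ln A / L)"
proof -
  have "ln (mass V L g x) \<le> ln A + mass V L g x / A - 1" if "x \<in> V" for x
    using ln_le_minus_one[of "mass V L g x / A"] mass_ge_1[OF V g that, of L] \<open>A > 0\<close>
    by (simp add: ln_div)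
  then have "(\<Sum>x\<in>V. ln (mass V L g x)) \<le> (\<Sum>x\<in>V. ln A + mass V L g x / A - 1)"
    by (rule sum_mono)
  also have "\<dots> = real (card V) * ln A + (\<Sum>x\<in>V. mass V L g x) / A - real (card V)"
    by (simp add: sum.distrib sum_subtractf sum_divide_distrib)
  also have "\<dots> \<le> real (card V) * ln A"
    using total \<open>A > 0\<close> by (simp add: field_simps)
  finally have "(\<Sum>x\<in>V. ln (mass V L g x)) / L \<le> real (card V) * ln A / L"
    using L by (intro divide_right_mono) auto
  then show ?thesis
    by (simp add: hub_def sum.distrib sum_divide_distrib algebra_simps)
qed

text \<open>The freedom left after the last query: hub distances may be raised to any Lipschitz
  function without contradicting an answer.\<close>

lemma consistent_via_hub:
  assumes V: "finite V" and g: "Metric_space V g" and L: "L > 0"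
    and ge: "\<And>x. x \<in> V \<Longrightarrow> hub V L g x \<le> h x"
    and lip: "\<And>x y. \<lbrakk>x \<in> V; y \<in> V\<rbrakk> \<Longrightarrow> h x \<le> g x y + h y"
  defines "d \<equiv> \<lambda>x y. if x \<in> V \<and> y \<in> V then via_hub g h x y else 0"
  shows "Metric_space V d" and "consistent V L g d"
proof -
  have "0 < h x" if "x \<in> V" for x
    using hub_ge_1[OF V g L that] ge[OF that] by linarith
  then show "Metric_space V d"
    unfolding d_def by (intro Metric_space_via_hub[OF g lip])
  have "hub V L g x + hub V L g y \<le> h x + h y" if "x \<in> V" "y \<in> V" for x y
    using that by (intro add_mono ge)
  then show "consistent V L g d"
    by (auto simp: consistent_def d_def via_hub_def intro: min.coboundedI2)
qed

section \<open>Costs, the optimum, and a metric that is bad for a given output\<close>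

lemma solutions_finite: "S \<in> solutions n k \<Longrightarrow> finite S"
  by (auto simp: solutions_def intro: finite_subset)

lemma finite_solutions: "finite (solutions n k)"
  by (rule finite_subset[of _ "Pow {..<n}"]) (auto simp: solutions_def)

lemma opt_le_cost: "S \<in> solutions n k \<Longrightarrow> opt n k d \<le> cost n d S"
  unfolding opt_def using finite_solutions by (intro Min_le) auto

lemma opt_nonneg:
  assumes "Metric_space {..<n} d" "S \<in> solutions n k"
  shows "0 \<le> opt n k d"
proof -
  have "0 \<le> cost n d T" if "T \<in> solutions n k" for T
    unfolding cost_def
  proof (rule sum_nonneg)
    fix x
    have "finite T" "T \<noteq> {}"
      using that solutions_finite[OF that] by (simp_all add: solutions_def)
    then show "0 \<le> dist_to d x T"
      using Metric_space.nonneg[OF assms(1)] by (simp add: dist_to_def)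
  qed
  then show ?thesis
    unfolding opt_def using finite_solutions assms(2) by (subst Min_ge_iff) auto
qed

lemma dist_to_lipschitz:
  assumes "Metric_space V g" "finite S" "S \<noteq> {}" "S \<subseteq> V" "x \<in> V" "y \<in> V"
  shows "dist_to g x S \<le> g x y + dist_to g y S"
proof -
  have "dist_to g y S \<in> g y ` S"
    unfolding dist_to_def using assms by (intro Min_in) auto
  then obtain s where s: "s \<in> S" "dist_to g y S = g y s" by blast
  have "dist_to g x S \<le> g x s"
    unfolding dist_to_def using assms s by (intro Min_le) auto
  also have "\<dots> \<le> g x y + g y s"
    using Metric_space.triangle[OF assms(1)] assms s by blast
  finally show ?thesis using s by simp
qed

text \<open>
  After the computation the hub distances near its output are raised, which leaves the answers
  unchanged; the point nearest to the hub is then a good center.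
\<close>
lemma final_metric:
  assumes g: "Metric_space {..<n} g" and L: "L > 0" and S: "S \<in> solutions n k"
    and "n \<ge> 1" "k \<ge> 1" "R \<ge> 0"
    and ball: "\<And>s. s < n \<Longrightarrow> real (card {x\<in>{..<n}. g s x < R}) \<le> b"
  obtains d where "Metric_space {..<n} d" "consistent {..<n} L g d"
    "R * (real n - real k * b) \<le> cost n d S"
    "opt n k d \<le> 2 * ((\<Sum>x<n. hub {..<n} L g x) + R * (real k * b))"
proof -
  interpret Metric_space "{..<n}" g by fact
  define p where "p x = dist_to g x S" for x
  \<comment> \<open>A maximum of two 1-Lipschitz functions. It is at least \<open>R\<close> on
    \<open>S\<close> and equals the old hub distance wherever \<open>p x\<close> is at least
    \<open>R\<close>.\<close>
  define h where "h x = max (hub {..<n} L g x) (R - p x)" for x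
  define d where "d x y = (if x \<in> {..<n} \<and> y \<in> {..<n} then via_hub g h x y else 0)" for x y
  define U where "U = {x\<in>{..<n}. p x < R}"
  have fin: "finite S" and ne: "S \<noteq> {}" and sub: "S \<subseteq> {..<n}" and card: "card S \<le> k"
    using S solutions_finite[OF S] by (simp_all add: solutions_def)
  have p_le: "p x \<le> g x s" if "s \<in> S" for x s
    unfolding p_def dist_to_def using fin that by (intro Min_le) auto
  have p_lip: "p x \<le> g x y + p y" if "x \<in> {..<n}" "y \<in> {..<n}" for x y
    unfolding p_def using dist_to_lipschitz[OF g fin ne sub that] .
  have h_lip: "h x \<le> g x y + h y" if "x \<in> {..<n}" "y \<in> {..<n}" for x y
    using hub_lipschitz[OF finite_lessThan g L that] p_lip[OF that(2,1)] commute[of x y]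
    by (auto simp: h_def)
  note d = consistent_via_hub[where h = h, OF finite_lessThan g L _ h_lip]
  have d_metric: "Metric_space {..<n} d" and d_cons: "consistent {..<n} L g d"
    unfolding d_def[abs_def] by (rule d; simp add: h_def)+
  have h_pos: "0 \<le> h x" if "x < n" for x
    using hub_ge_1[OF finite_lessThan g L, of x] that by (simp add: h_def)

  have "U \<subseteq> (\<Union>s\<in>S. {x\<in>{..<n}. g s x < R})"
  proof
    fix x assume "x \<in> U"
    moreover have "p x \<in> g x ` S"
      unfolding p_def dist_to_def using fin ne by (intro Min_in) auto
    ultimately show "x \<in> (\<Union>s\<in>S. {x\<in>{..<n}. g s x < R})"
      by (auto simp: U_def commute)
  qed
  then have "card U \<le> card (\<Union>s\<in>S. {x\<in>{..<n}. g s x < R})"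
    using fin by (intro card_mono) simp_all
  also have "\<dots> \<le> (\<Sum>s\<in>S. card {x\<in>{..<n}. g s x < R})"
    by (rule card_UN_le[OF fin])
  finally have "real (card U) \<le> (\<Sum>s\<in>S. real (card {x\<in>{..<n}. g s x < R}))"
    unfolding of_nat_sum[symmetric] of_nat_le_iff .
  also have "\<dots> \<le> real (card S) * b"
    using ball sub by (intro sum_bounded_above) auto
  also have "\<dots> \<le> real k * b"
  proof (rule mult_right_mono)
    show "0 \<le> b" using ball[of 0] \<open>n \<ge> 1\<close> order_trans[OF of_nat_0_le_iff] by simp
  qed (use card in simp)
  finally have U: "real (card U) \<le> real k * b" .
  have U_sub: "U \<subseteq> {..<n}" by (auto simp: U_def)

  \<comment> \<open>Both routes from such an \<open>x\<close> to \<open>s\<close> have length at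
    least \<open>R\<close>: the direct one since \<open>x\<close> is outside \<open>U\<close>, the
    other since \<open>h s\<close> is at least \<open>R\<close>.\<close>
  have far: "R \<le> dist_to d x S" if "x \<in> {..<n} - U" for x
  proof -
    have "R \<le> d x s" if s: "s \<in> S" for s
    proof -
      have "p s \<le> 0" using p_le[OF s, of s] sub s by auto
      then have "R \<le> h s" by (simp add: h_def)
      moreover have "R \<le> g x s" using p_le[OF s, of x] \<open>x \<in> {..<n} - U\<close> by (auto simp: U_def)
      ultimately show ?thesis
        using sub s h_pos[of x] \<open>x \<in> {..<n} - U\<close> by (auto simp: d_def via_hub_def)
    qed
    then show ?thesis unfolding dist_to_def using fin ne by simp
  qed
  have "R * (real n - real k * b) \<le> R * (real n - real (card U))"
    using U \<open>R \<ge> 0\<close> by (intro mult_left_mono) auto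
  also have "\<dots> = (\<Sum>x\<in>{..<n} - U. R)"
    using U_sub card_mono[OF _ U_sub]
    by (simp add: card_Diff_subset finite_subset[OF U_sub] of_nat_diff)
  also have "\<dots> \<le> (\<Sum>x\<in>{..<n} - U. dist_to d x S)"
    by (intro sum_mono far)
  also have "\<dots> \<le> cost n d S"
    unfolding cost_def
  proof (intro sum_mono2)
    fix x
    show "0 \<le> dist_to d x S"
      unfolding dist_to_def using fin ne Metric_space.nonneg[OF d_metric] by simp
  qed auto
  finally have cost: "R * (real n - real k * b) \<le> cost n d S" .

  have "(\<Sum>x<n. h x) \<le> (\<Sum>x<n. hub {..<n} L g x + (if x \<in> U then R else 0))"
  proof (intro sum_mono)
    fix x assume "x \<in> {..<n}"
    moreover have "0 \<le> p x"
      unfolding p_def dist_to_def using fin ne by simp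
    ultimately show "h x \<le> hub {..<n} L g x + (if x \<in> U then R else 0)"
      using hub_ge_1[OF finite_lessThan g L, of x] \<open>R \<ge> 0\<close> by (auto simp: h_def U_def)
  qed
  also have "\<dots> = (\<Sum>x<n. hub {..<n} L g x) + R * real (card U)"
    using U_sub by (simp add: sum.distrib sum.If_cases Int_absorb1)
  also have "\<dots> \<le> (\<Sum>x<n. hub {..<n} L g x) + R * (real k * b)"
    using U \<open>R \<ge> 0\<close> by (intro add_left_mono mult_left_mono)
  finally have sum_h: "(\<Sum>x<n. h x) \<le> (\<Sum>x<n. hub {..<n} L g x) + R * (real k * b)" .

  \<comment> \<open>The hub is not a point of the space; replacing it by the nearest point at most
    doubles the sum of the distances.\<close>
  have "Min (h ` {..<n}) \<in> h ` {..<n}"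
    using \<open>n \<ge> 1\<close> by (intro Min_in) (auto simp: lessThan_empty_iff)
  then obtain v where v: "v < n" "Min (h ` {..<n}) = h v" by auto
  then have v_min: "h v \<le> h x" if "x < n" for x
    using that by (metis Min_le finite_imageI finite_lessThan imageI lessThan_iff)
  have "opt n k d \<le> cost n d {v}"
    using v(1) \<open>k \<ge> 1\<close> by (intro opt_le_cost) (simp add: solutions_def)
  also have "\<dots> \<le> (\<Sum>x<n. h x + h x)"
    unfolding cost_def
  proof (intro sum_mono)
    fix x assume "x \<in> {..<n}"
    then show "dist_to d x {v} \<le> h x + h x"
      using v(1) v_min[of x] by (simp add: dist_to_def d_def via_hub_def)
  qed
  also have "\<dots> = 2 * (\<Sum>x<n. h x)" by (simp only: sum.distrib mult_2)
  also have "\<dots> \<le> 2 * ((\<Sum>x<n. hub {..<n} L g x) + R * (real k * b))"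
    by (rule mult_left_mono[OF sum_h]) simp
  finally have "opt n k d \<le> 2 * ((\<Sum>x<n. hub {..<n} L g x) + R * (real k * b))" .
  with that d_metric d_cons cost show ?thesis by blast
qed

section \<open>From costs to the approximation ratio, and the initial metric\<close>

text \<open>The special values of \<open>cost_ratio\<close> are covered too: equal costs give 1, and
  a positive cost against optimum 0 gives \<infinity>.\<close>

lemma cost_ratio_ge:
  assumes "0 \<le> b" "b \<le> a" "r * b \<le> a" "a = b \<Longrightarrow> r \<le> 1"
  shows "ereal r \<le> cost_ratio a b"
proof (cases "a = b")
  case True
  then show ?thesis using assms(4) by (simp add: cost_ratio_def one_ereal_def)
next
  case False
  show ?thesis
  proof (cases "b = 0")
    case True
    then show ?thesis using False assms by (simp add: cost_ratio_def)
  next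
    case b: False
    then show ?thesis using False assms by (simp add: cost_ratio_def field_simps)
  qed
qed

lemma approximation_ratio_ge:
  assumes "Metric_space {..<n} d" "result (A n k) d \<in> solutions n k"
    and "r * opt n k d \<le> cost n d (result (A n k) d)"
    and "cost n d (result (A n k) d) = opt n k d \<Longrightarrow> r \<le> 1"
  shows "ereal r \<le> approximation_ratio A n k"
proof -
  have "ereal r \<le> cost_ratio (cost n d (result (A n k) d)) (opt n k d)"
    using assms opt_nonneg opt_le_cost by (intro cost_ratio_ge) auto
  also have "\<dots> \<le> approximation_ratio A n k"
    unfolding approximation_ratio_def using assms(1) by (intro SUP_upper) simp
  finally show ?thesis .
qed

lemma Metric_space_discrete:
  fixes M :: real
  assumes "M > 0"
  shows "Metric_space V (\<lambda>x y. if x = y then 0 else M)"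
  using assms by unfold_locales auto

text \<open>At distance \<open>ln (card V) / L\<close> every other point has weight
  \<open>1 / card V\<close>, so together they add at most 1 to the weight 1 of \<open>x\<close>
  itself.\<close>

lemma sum_mass_discrete_le:
  assumes "finite V" "V \<noteq> {}" "L > 0"
  shows "(\<Sum>x\<in>V. mass V L (\<lambda>x y. if x = y then 0 else ln (card V) / L) x) \<le> real (card V) * 2"
proof -
  have pos: "0 < card V" using assms by (simp add: card_gt_0_iff)
  have "mass V L (\<lambda>x y. if x = y then 0 else ln (card V) / L) x \<le> 2" if "x \<in> V" for x
  proof -
    have "mass V L (\<lambda>x y. if x = y then 0 else ln (card V) / L) x
        \<le> (\<Sum>y\<in>V. (if x = y then 1 else 0) + 1 / card V)"
      unfolding mass_def using pos \<open>L > 0\<close>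
      by (intro sum_mono) (simp add: exp_minus inverse_eq_divide)
    also have "\<dots> = 2" using assms that pos by (simp add: sum.distrib)
    finally show ?thesis .
  qed
  then show ?thesis by (rule sum_bounded_above)
qed

section \<open>Choice of parameters and the final bound\<close>

lemma approximation_ratio_lower_bound:
  fixes C \<delta> :: real and n k :: nat
  defines "l \<equiv> ln (real n)"
  defines "L \<equiv> ln l + ln (real k) + ln \<delta>"
  assumes A: "kmedian_algorithm A" and "n \<ge> 1" "k \<ge> 1" "\<delta> \<ge> 1" "C > 0"
    and l: "exp 1 \<le> l" "2 + 2 * C \<le> l" and "4 * L \<le> l"
    and time: "\<And>d. Metric_space {..<n} d \<Longrightarrow>
      real (running_time (A n k) d) \<le> C * (real k * real n * \<delta>)"
  shows "ereal (1 / 50 * (l / L)) \<le> approximation_ratio A n k"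
proof -
  have "0 < l" using l(1) exp_gt_zero[of 1] by linarith
  have "1 \<le> ln l" using l(1) \<open>0 < l\<close> by (simp add: ln_ge_iff)
  moreover have "0 \<le> ln (real k)" "0 \<le> ln \<delta>" using \<open>k \<ge> 1\<close> \<open>\<delta> \<ge> 1\<close> by auto
  ultimately have "1 \<le> L" by (simp add: L_def)
  then have "0 < L" by simp
  \<comment> \<open>\<open>L\<close> is chosen so that \<open>exp L\<close> exceeds the average
    mass, at most \<open>(2 + 2 * C) * (real k * \<delta>)\<close>.\<close>
  have expL: "exp L = l * real k * \<delta>"
    using \<open>0 < l\<close> \<open>k \<ge> 1\<close> \<open>\<delta> \<ge> 1\<close> by (simp add: L_def exp_add)
  have expl: "exp l = real n" using \<open>n \<ge> 1\<close> by (simp add: l_def)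
  let ?V = "{..<n}"
  let ?g0 = "\<lambda>x y. if x = y then 0 else l / L"
  have g0: "Metric_space ?V ?g0"
    using \<open>0 < l\<close> \<open>0 < L\<close> by (intro Metric_space_discrete) simp
  obtain g S m where g: "sharpens ?V L g ?g0"
      "(\<Sum>x<n. mass ?V L g x) \<le> (\<Sum>x<n. mass ?V L ?g0 x) + 2 * real m"
      "\<And>d. consistent ?V L g d \<Longrightarrow> result (A n k) d = S \<and> m \<le> running_time (A n k) d"
    using adversary[OF finite_lessThan \<open>0 < L\<close> g0, of "A n k"] by blast
  have metric: "Metric_space ?V g" using g(1) by (simp add: sharpens_def)
  \<comment> \<open>The assumption on the running time speaks of actual metrics, so bounding
    \<open>m\<close> takes one consistent metric; the unraised hub distances supply it.\<close>
  obtain d0 where d0: "Metric_space ?V d0" "consistent ?V L g d0"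
    using consistent_via_hub[OF finite_lessThan metric \<open>0 < L\<close> order_refl]
      hub_lipschitz[OF finite_lessThan metric \<open>0 < L\<close>] by blast
  have S: "S \<in> solutions n k"
    using A g(3)[OF d0(2)] d0(1) \<open>n \<ge> 1\<close> \<open>k \<ge> 1\<close> unfolding kmedian_algorithm_def by blast
  have "real m \<le> C * (real k * real n * \<delta>)"
    using g(3)[OF d0(2)] time[OF d0(1)] by (meson of_nat_mono order_trans)
  moreover have "(\<Sum>x<n. mass ?V L ?g0 x) \<le> real n * 2"
    using sum_mass_discrete_le[OF finite_lessThan _ \<open>0 < L\<close>, of n] \<open>n \<ge> 1\<close>
    unfolding card_lessThan l_def by (simp add: lessThan_empty_iff)
  ultimately have "(\<Sum>x<n. mass ?V L g x) \<le> real n * (2 + 2 * C * (real k * \<delta>))"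
    using g(2) by (simp add: algebra_simps)
  also have "2 + 2 * C * (real k * \<delta>) \<le> (2 + 2 * C) * (real k * \<delta>)"
  proof -
    have "1 \<le> real k * \<delta>"
      using \<open>k \<ge> 1\<close> \<open>\<delta> \<ge> 1\<close> mult_mono[of 1 "real k" 1 \<delta>] by simp
    then show ?thesis by (simp add: algebra_simps)
  qed
  also have "\<dots> \<le> exp L"
    using l(2) \<open>k \<ge> 1\<close> \<open>\<delta> \<ge> 1\<close> unfolding expL mult.assoc by (intro mult_right_mono) auto
  finally have total: "(\<Sum>x<n. mass ?V L g x) \<le> real n * exp L"
    by (simp add: mult_left_mono)
  have sum_hub: "(\<Sum>x<n. hub ?V L g x) \<le> 2 * real n"
    using sum_hub_le[OF finite_lessThan metric \<open>0 < L\<close> exp_gt_zero, of L] total \<open>0 < L\<close> by simp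

  \<comment> \<open>With this radius \<open>2 * L * R = l / 4\<close>, so a squared ball size is at
    most \<open>exp (l / 4 + l + L)\<close>, which is the square of \<open>b\<close>.\<close>
  define R where "R = l / (8 * L)"
  define b where "b = exp (5 * l / 8 + L / 2)"
  have "1 / 2 \<le> R" using \<open>4 * L \<le> l\<close> \<open>0 < L\<close> by (simp add: R_def field_simps)
  have ball: "real (card {x\<in>?V. g s x < R}) \<le> b" if "s < n" for s
  proof (rule power2_le_imp_le)
    have "(real (card {x\<in>?V. g s x < R}))\<^sup>2 \<le> exp (2 * L * R) * (\<Sum>x<n. mass ?V L g x)"
      using card_ball_squared_le[OF finite_lessThan metric \<open>0 < L\<close>] that by simp
    also have "\<dots> \<le> exp (2 * L * R) * (real n * exp L)"
      using total by (intro mult_left_mono) auto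
    also have "\<dots> = exp (l / 4) * (exp l * exp L)"
      using \<open>0 < L\<close> by (simp add: R_def expl)
    also have "\<dots> = b\<^sup>2"
      by (simp add: b_def power2_eq_square flip: exp_add)
    finally show "(real (card {x\<in>?V. g s x < R}))\<^sup>2 \<le> b\<^sup>2" .
  qed (simp add: b_def)
  \<comment> \<open>The factor \<open>l * real k\<close> is at most \<open>exp L\<close>, and
    \<open>3 * L / 2\<close> is at most \<open>3 * l / 8\<close>, which completes the exponent
    \<open>5 * l / 8\<close> to \<open>l\<close>.\<close>
  have near: "R * (real k * b) \<le> real n / 8"
  proof -
    have "R \<le> l / 8"
      using \<open>1 \<le> L\<close> \<open>0 < l\<close> by (simp add: R_def field_simps)
    then have "R * (real k * b) \<le> l / 8 * (real k * b)"
      by (intro mult_right_mono) (auto simp: b_def)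
    also have "\<dots> = (l * real k * 1) * b / 8" by simp
    also have "\<dots> \<le> exp L * b / 8"
      unfolding expL using \<open>\<delta> \<ge> 1\<close> \<open>0 < l\<close>
      by (intro divide_right_mono mult_right_mono mult_left_mono) (auto simp: b_def)
    also have "\<dots> = exp (5 * l / 8 + 3 * L / 2) / 8"
      by (simp add: b_def flip: exp_add)
    also have "\<dots> \<le> exp l / 8"
      using \<open>4 * L \<le> l\<close> by (intro divide_right_mono) auto
    finally show ?thesis by (simp add: expl)
  qed
  obtain d where d: "Metric_space ?V d" "consistent ?V L g d"
      "R * (real n - real k * b) \<le> cost n d S"
      "opt n k d \<le> 2 * ((\<Sum>x<n. hub ?V L g x) + R * (real k * b))"
    using final_metric[OF metric \<open>0 < L\<close> S \<open>n \<ge> 1\<close> \<open>k \<ge> 1\<close> _ ball] \<open>1 / 2 \<le> R\<close> by auto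
  \<comment> \<open>17/4 = 2 (2 + 1/8).\<close>
  have opt: "opt n k d \<le> 17 / 4 * real n" 
    using d(4) add_mono[OF sum_hub near] by (simp add: field_simps)
  have "real n / 8 \<le> R * real n / 4"
    using \<open>1 / 2 \<le> R\<close> mult_right_mono[of "1 / 2" R "real n"] by simp
  then have cost: "3 / 4 * R * real n \<le> cost n d S"
    using d(3) near by (simp add: algebra_simps)
  \<comment> \<open>Since r = (4/25) R, one gets (17/4) r = (17/25) R, which is below (3/4)
    R.\<close>
  define r where "r = 1 / 50 * (l / L)"
  have "r = 4 / 25 * R" using \<open>0 < L\<close> by (simp add: r_def R_def)
  then have r: "0 \<le> r" "r * (17 / 4 * real n) \<le> 3 / 4 * R * real n"
    using \<open>1 / 2 \<le> R\<close> mult_right_mono[of "17 * r" "3 * R" "real n"] by auto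
  have "result (A n k) d = S" using g(3) d(2) by blast
  moreover have "r * opt n k d \<le> cost n d S"
    using mult_left_mono[OF opt r(1)] r(2) cost by linarith
  moreover have "r \<le> 1" if "cost n d S = opt n k d"
  proof -
    have "r * (17 / 4 * real n) \<le> 1 * (17 / 4 * real n)"
      using r(2) cost opt that by linarith
    then show ?thesis by (rule mult_right_le_imp_le) (use \<open>n \<ge> 1\<close> in simp)
  qed
  ultimately show ?thesis
    unfolding r_def[symmetric] using d(1) S by (intro approximation_ratio_ge[of n d]) auto
qed

text \<open>The factor \<open>c\<close> is 1/50 for every \<open>C\<close>; only the threshold for
  \<open>n\<close> depends on \<open>C\<close>, and it is uniform in \<open>k\<close>, \<delta> and
  the algorithm.\<close>

theorem theorem6p1:
  "\<forall>C::real. C > 0 \<longrightarrow> (\<exists>c::real. c > 0 \<and> (\<exists>n\<^sub>0::nat.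
    \<forall>\<delta>::real. \<delta> \<ge> 1 \<longrightarrow> (\<forall>A. kmedian_algorithm A \<longrightarrow>
      (\<forall>n\<ge>n\<^sub>0. \<forall>k\<ge>1.
        (\<forall>d. Metric_space {..<n} d \<longrightarrow>
          real (running_time (A n k) d) \<le> C * (real k * real n * \<delta>)) \<longrightarrow>
        approximation_ratio A n k
          \<ge> ereal (c * (ln (real n) / (ln (ln (real n)) + ln (real k) + ln \<delta>)))))))"
proof (intro allI impI)
  fix C :: real assume "C > 0"
  define n0 where "n0 = nat \<lceil>exp (max (exp 1) (2 + 2 * C))\<rceil>"
  have "ereal (1 / 50 * (ln (real n) / (ln (ln (real n)) + ln (real k) + ln \<delta>)))
      \<le> approximation_ratio A n k"
    if "\<delta> \<ge> 1" and A: "kmedian_algorithm A" and "n \<ge> n0" and "k \<ge> 1"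
      and time: "\<forall>d. Metric_space {..<n} d \<longrightarrow>
        real (running_time (A n k) d) \<le> C * (real k * real n * \<delta>)"
    for \<delta> A n k
  proof -
    have n0: "exp (max (exp 1) (2 + 2 * C)) \<le> real n"
      using \<open>n \<ge> n0\<close> by (simp add: n0_def nat_ceiling_le_eq)
    then have "0 < real n" using exp_gt_zero by (rule less_le_trans[rotated])
    then have "n \<ge> 1" by simp
    have l: "exp 1 \<le> ln (real n)" "2 + 2 * C \<le> ln (real n)"
      using n0 \<open>0 < real n\<close> by (simp_all flip: ln_ge_iff)
    show ?thesis
    proof (cases "4 * (ln (ln (real n)) + ln (real k) + ln \<delta>) \<le> ln (real n)")
      case True
      then show ?thesis
        using approximation_ratio_lower_bound[OF A \<open>n \<ge> 1\<close> \<open>k \<ge> 1\<close> \<open>\<delta> \<ge> 1\<close> \<open>C > 0\<close> l] time by blast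
    next
      case False
      \<comment> \<open>Now the claimed bound is below 4/50, hence at most 1, and any metric shows a
        ratio of at least 1; the discrete one serves.\<close>
      let ?d = "\<lambda>x y::nat. if x = y then 0 else 1 :: real"
      have d: "Metric_space {..<n} ?d" by (rule Metric_space_discrete) simp
      then have S: "result (A n k) ?d \<in> solutions n k"
        using A \<open>n \<ge> 1\<close> \<open>k \<ge> 1\<close> unfolding kmedian_algorithm_def by blast
      have "0 < ln (real n)" using l(1) exp_gt_zero[of "1::real"] by linarith
      then have r: "1 / 50 * (ln (real n) / (ln (ln (real n)) + ln (real k) + ln \<delta>)) \<le> 1"
        using False by (simp add: divide_simps)
      show ?thesis
      proof (rule approximation_ratio_ge[where d = ?d and A = A and n = n and k = k, OF d S])
        show "1 / 50 * (ln (real n) / (ln (ln (real n)) + ln (real k) + ln \<delta>)) * opt n k ?d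
            \<le> cost n ?d (result (A n k) ?d)"
          using mult_right_mono[OF r opt_nonneg[OF d S]] opt_le_cost[OF S, of ?d] by linarith
      qed (rule r)
    qed
  qed
  then show "\<exists>c>0. \<exists>n0. \<forall>\<delta>\<ge>1. \<forall>A. kmedian_algorithm A \<longrightarrow> (\<forall>n\<ge>n0. \<forall>k\<ge>1.
      (\<forall>d. Metric_space {..<n} d \<longrightarrow>
        real (running_time (A n k) d) \<le> C * (real k * real n * \<delta>)) \<longrightarrow>
      ereal (c * (ln (real n) / (ln (ln (real n)) + ln (real k) + ln \<delta>)))
        \<le> approximation_ratio A n k)"
    by (intro exI[of _ "1 / 50"] exI[of _ n0] conjI) auto
qed

end
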